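(* Let $(X,f_{1,\infty})$ be an NDS, $n\in\mathbb{N}$, $r\in\mathbb{N}$ and $\mathbf{a}=(a_1,a_2,\dots,a_r)\in\mathbb{N}^r$. Then the following conditions are equivalent: (1) $(X,f_{1,\infty})$ is strongly multi-transitive; (2) $(X,f_{1,\infty}^{[n]})$ is strongly multi-transitive; (3) $(X^r,f_{1,\infty}^{[\mathbf{a}]})$ is strongly multi-transitive; (4) for each $k\in\mathbb{N}$, $(X^k,f_{1,\infty}\times f_{1,\infty}^{[2]}\times\cdots\times f_{1,\infty}^{[k]})$ is weakly mixing of all orders.
   Context: $\mathbb{N}=\{1,2,3,\dots\}$. A non-autonomous discrete dynamical system (NDS) $(X,f_{1,\infty})$ consists of a compact metric space $(X,d)$ and a sequence $f_{1,\infty}=\{f_n\}_{n=1}^\infty$ of continuous maps $f_n:X\to X$. For $i,n\in\mathbb{N}$, $f_i^n:=f_{i+(n-1)}\circ\cdots\circ f_i$, and $f_i^0=\mathrm{id}_X$. For $k\in\mathbb{N}$, the $k$-th iterate is the NDS on $X$ given by $f_{1,\infty}^{[k]}:=\{f_{k(n-1)+1}^k\}_{n=1}^\infty$ (so the composition of its first $n$ maps is $f_1^{kn}$). Products of NDS are taken termwise: the $n$-th map of a product system is the product of the $n$-th maps of the factors. For $\mathbf{a}=(a_1,\dots,a_p)\in\mathbb{N}^p$, $f_{1,\infty}^{[\mathbf{a}]}:=f_{1,\infty}^{[a_1]}\times\cdots\times f_{1,\infty}^{[a_p]}$, an NDS on $X^p$. Definitions (for any NDS). Transitive: for any nonempty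 open $U,V\subseteq X$ there is $n\in\mathbb{N}$ with $f_1^n(U)\cap V\neq\emptyset$. Weakly mixing of order $n$ ($n\ge2$): for any nonempty open $U_1,\dots,U_n,V_1,\dots,V_n\subseteq X$ there is $m\in\mathbb{N}$ with $f_1^m(U_i)\cap V_i\neq\emptyset$ for all $i=1,\dots,n$; weakly mixing of all orders: weakly mixing of order $n$ for every $n\ge2$. Multi-transitive with respect to $\mathbf{a}\in\mathbb{N}^p$: $(X^p,f_{1,\infty}^{[\mathbf{a}]})$ is transitive. Strongly multi-transitive: multi-transitive with respect to every vector in $\mathbb{N}^p$, for every $p\in\mathbb{N}$. *)

theory Defs
  imports "HOL-Analysis.Analysis"
begin

text \<open>
  A system is a space \<open>X\<close> with a sequence of self-maps \<open>f 1, f 2, \<dots>\<close>; the value \<open>f 0\<close> is never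
  used. All notions below depend on the metric only through its topology, so a compact metric
  space is represented by a topology that is compact and induced by some metric. This allows the
  powers of \<open>X\<close> to carry the product topology.
\<close>

definition nds :: "'a topology \<Rightarrow> (nat \<Rightarrow> 'a \<Rightarrow> 'a) \<Rightarrow> bool" where
  "nds X f \<longleftrightarrow> compact_space X \<and> metrizable_space X \<and> (\<forall>n\<ge>1. continuous_map X X (f n))"

text \<open>\<open>nds_comp f i n\<close> is \<open>f (i + n - 1) \<circ> \<dots> \<circ> f i\<close>, with \<open>n\<close> factors.\<close>

primrec nds_comp :: "(nat \<Rightarrow> 'a \<Rightarrow> 'a) \<Rightarrow> nat \<Rightarrow> nat \<Rightarrow> 'a \<Rightarrow> 'a" where
  "nds_comp f i 0 = id"
| "nds_comp f i (Suc n) = f (i + n) \<circ> nds_comp f i n"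

definition nds_iterate :: "(nat \<Rightarrow> 'a \<Rightarrow> 'a) \<Rightarrow> nat \<Rightarrow> nat \<Rightarrow> 'a \<Rightarrow> 'a" where
  "nds_iterate f k = (\<lambda>n. nds_comp f (k * (n - 1) + 1) k)"

text \<open>
  Points of the \<open>p\<close>-th power are functions on \<open>{1..p}\<close>, extended by \<open>undefined\<close> as in
  \<^const>\<open>product_topology\<close>; the maps of a product system are restricted accordingly.
\<close>

definition power_space :: "'a topology \<Rightarrow> nat \<Rightarrow> (nat \<Rightarrow> 'a) topology" where
  "power_space X p = product_topology (\<lambda>_. X) {1..p}"

definition nds_product ::
    "nat \<Rightarrow> (nat \<Rightarrow> nat \<Rightarrow> 'a \<Rightarrow> 'a) \<Rightarrow> nat \<Rightarrow> (nat \<Rightarrow> 'a) \<Rightarrow> (nat \<Rightarrow> 'a)" where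
  "nds_product p F = (\<lambda>n x. \<lambda>i\<in>{1..p}. F i n (x i))"

definition nds_vector ::
    "(nat \<Rightarrow> 'a \<Rightarrow> 'a) \<Rightarrow> nat \<Rightarrow> (nat \<Rightarrow> nat) \<Rightarrow> nat \<Rightarrow> (nat \<Rightarrow> 'a) \<Rightarrow> (nat \<Rightarrow> 'a)" where
  "nds_vector f p a = nds_product p (\<lambda>i. nds_iterate f (a i))"

definition transitive_nds :: "'a topology \<Rightarrow> (nat \<Rightarrow> 'a \<Rightarrow> 'a) \<Rightarrow> bool" where
  "transitive_nds X f \<longleftrightarrow>
     (\<forall>U V. openin X U \<and> U \<noteq> {} \<and> openin X V \<and> V \<noteq> {} \<longrightarrow>
        (\<exists>n\<ge>1. nds_comp f 1 n ` U \<inter> V \<noteq> {}))"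

definition weakly_mixing_of_order :: "nat \<Rightarrow> 'a topology \<Rightarrow> (nat \<Rightarrow> 'a \<Rightarrow> 'a) \<Rightarrow> bool" where
  "weakly_mixing_of_order n X f \<longleftrightarrow>
     (\<forall>U V. (\<forall>i\<in>{1..n}. openin X (U i) \<and> U i \<noteq> {} \<and> openin X (V i) \<and> V i \<noteq> {}) \<longrightarrow>
        (\<exists>m\<ge>1. \<forall>i\<in>{1..n}. nds_comp f 1 m ` U i \<inter> V i \<noteq> {}))"

definition weakly_mixing_all_orders :: "'a topology \<Rightarrow> (nat \<Rightarrow> 'a \<Rightarrow> 'a) \<Rightarrow> bool" where
  "weakly_mixing_all_orders X f \<longleftrightarrow> (\<forall>n\<ge>2. weakly_mixing_of_order n X f)"

definition multi_transitive ::
    "'a topology \<Rightarrow> (nat \<Rightarrow> 'a \<Rightarrow> 'a) \<Rightarrow> nat \<Rightarrow> (nat \<Rightarrow> nat) \<Rightarrow> bool" where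
  "multi_transitive X f p a \<longleftrightarrow> transitive_nds (power_space X p) (nds_vector f p a)"

definition strongly_multi_transitive :: "'a topology \<Rightarrow> (nat \<Rightarrow> 'a \<Rightarrow> 'a) \<Rightarrow> bool" where
  "strongly_multi_transitive X f \<longleftrightarrow>
     (\<forall>p\<ge>1. \<forall>a. (\<forall>i\<in>{1..p}. a i \<ge> 1) \<longrightarrow> multi_transitive X f p a)"

lemma continuous_map_nds_comp:
  assumes "nds X f" "i \<ge> 1"
  shows "continuous_map X X (nds_comp f i n)"
proof (induction n)
  case 0
  then show ?case by (simp add: id_def)
next
  case (Suc n)
  moreover have "continuous_map X X (f (i + n))"
    using assms by (simp add: nds_def)
  ultimately show ?case
    unfolding nds_comp.simps by (rule continuous_map_compose)
qed

lemma nds_nds_iterate: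
  assumes "nds X f"
  shows "nds X (nds_iterate f k)"
  using assms continuous_map_nds_comp[OF assms] by (simp add: nds_def nds_iterate_def)

lemma nds_nds_product:
  assumes "\<And>i. i \<in> {1..p} \<Longrightarrow> nds X (F i)" "p \<ge> 1"
  shows "nds (power_space X p) (nds_product p F)"
proof -
  have X: "compact_space X" "metrizable_space X"
    using assms(1)[of 1] assms(2) by (auto simp: nds_def)
  have "continuous_map (power_space X p) (power_space X p) (nds_product p F n)" if "n \<ge> 1" for n
    unfolding power_space_def nds_product_def continuous_map_componentwise
  proof (intro conjI ballI)
    fix i assume i: "i \<in> {1..p}"
    have "continuous_map X X (F i n)"
      using assms(1)[OF i] that by (simp add: nds_def)
    then have "continuous_map (product_topology (\<lambda>_. X) {1..p}) X (F i n \<circ> (\<lambda>x. x i))"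
      using continuous_map_product_projection[OF i, of "\<lambda>_. X"] continuous_map_compose by blast
    then show "continuous_map (product_topology (\<lambda>_. X) {1..p}) X
        (\<lambda>x. (\<lambda>i\<in>{1..p}. F i n (x i)) i)"
      using i by (simp add: o_def)
  qed auto
  moreover have "compact_space (power_space X p)"
    using X(1) by (simp add: power_space_def compact_space_product_topology)
  moreover have "metrizable_space (power_space X p)"
    using X(2) by (simp add: power_space_def metrizable_space_product_topology countable_finite)
  ultimately show ?thesis by (simp add: nds_def)
qed

lemma nds_comp_add: "nds_comp f i (m + n) = nds_comp f (i + m) n \<circ> nds_comp f i m"
  by (induction n) (simp_all add: o_assoc add.assoc)

lemma nds_comp_nds_iterate: "nds_comp (nds_iterate f k) 1 n = nds_comp f 1 (k * n)"
proof (induction n)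
  case (Suc n)
  then have "nds_comp (nds_iterate f k) 1 (Suc n) = nds_comp f (1 + k * n) k \<circ> nds_comp f 1 (k * n)"
    by (simp add: nds_iterate_def)
  also have "\<dots> = nds_comp f 1 (k * n + k)"
    by (rule nds_comp_add[symmetric])
  finally show ?case by (simp add: add.commute)
qed simp

end

theory Submission
  imports Defs
begin

text \<open>
  Write \<open>g m\<close> for the composition of the first \<open>m\<close> maps. Testing on boxes, strong
  multi-transitivity says that for finitely many \<open>c i \<ge> 1\<close> and nonempty open \<open>U i\<close>, \<open>V i\<close> some
  \<open>m \<ge> 1\<close> makes \<open>g (c i * m)\<close> map a point of \<open>U i\<close> into \<open>V i\<close> for all \<open>i\<close>. The other conditions are
  of the same kind, for families \<open>c\<close> of the form \<open>n * b j\<close>, \<open>a i * b j\<close> and \<open>i\<close> (with repetitions).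
  They are special cases of the first; conversely, boxes with equal sides, together with the
  substitution of \<open>n * m\<close> or \<open>a 1 * m\<close> for \<open>m\<close>, recover the first.
\<close>

section \<open>Boxes in powers of a space and their orbits\<close>

lemma openin_power_space_contains_box:
  assumes "openin (power_space X p) W" "W \<noteq> {}"
  obtains U where "\<And>i. i \<in> {1..p} \<Longrightarrow> openin X (U i)" "\<And>i. i \<in> {1..p} \<Longrightarrow> U i \<noteq> {}"
    "Pi\<^sub>E {1..p} U \<subseteq> W"
proof -
  obtain x where "x \<in> W" using assms(2) by blast
  moreover have "\<forall>x\<in>W. \<exists>U. finite {i \<in> {1..p}. U i \<noteq> topspace X} \<and>
      (\<forall>i\<in>{1..p}. openin X (U i)) \<and> x \<in> Pi\<^sub>E {1..p} U \<and> Pi\<^sub>E {1..p} U \<subseteq> W"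
    using assms(1) by (simp only: power_space_def openin_product_topology_alt)
  ultimately obtain U where U: "\<forall>i\<in>{1..p}. openin X (U i)" "x \<in> Pi\<^sub>E {1..p} U" "Pi\<^sub>E {1..p} U \<subseteq> W"
    by metis
  \<comment> \<open>Each side contains a coordinate of the chosen point \<open>x\<close>.\<close>
  have "U i \<noteq> {}" if "i \<in> {1..p}" for i
    using PiE_mem[OF U(2) that] by auto
  with U(1,3) show thesis by (intro that) auto
qed

lemma openin_power_space_box:
  assumes "\<And>i. i \<in> {1..p} \<Longrightarrow> openin X (U i)"
  shows "openin (power_space X p) (Pi\<^sub>E {1..p} U)"
  using assms unfolding power_space_def by (intro openin_PiE_gen[THEN iffD2]) auto

lemma nds_comp_nds_product:
  assumes "i \<in> {1..p}"
  shows "nds_comp (nds_product p F) j m x i = nds_comp (F i) j m (x i)"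
  using assms by (induction m) (auto simp: nds_product_def)

text \<open>For \<open>m = 0\<close> the composition is the identity and returns the extensional
  \<open>x\<close>. For \<open>m > 0\<close> the outermost map already restricts its value to
  \<open>{1..p}\<close>.\<close>

lemma nds_comp_nds_product_extensional:
  assumes "x \<in> extensional {1..p}"
  shows "nds_comp (nds_product p F) j m x \<in> extensional {1..p}"
  using assms by (cases m) (auto simp: nds_product_def)

text \<open>Coordinates evolve independently, the \<open>i\<close>-th one under
  \<open>nds_comp f 1 (a i * m)\<close>. Hence witnesses can be chosen side by side and assembled
  into one point of the box.\<close>

lemma nds_comp_nds_vector_box:
  "nds_comp (nds_vector f p a) 1 m ` Pi\<^sub>E {1..p} U \<inter> Pi\<^sub>E {1..p} V \<noteq> {} \<longleftrightarrow>
     (\<forall>i\<in>{1..p}. nds_comp f 1 (a i * m) ` U i \<inter> V i \<noteq> {})"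
  (is "?L \<longleftrightarrow> ?R")
proof -
  have comp: "nds_comp (nds_vector f p a) 1 m x i = nds_comp f 1 (a i * m) (x i)"
    if "i \<in> {1..p}" for i x
    unfolding nds_vector_def nds_comp_nds_product[OF that] nds_comp_nds_iterate ..
  show ?thesis
  proof
    assume ?L
    then obtain x where x: "x \<in> Pi\<^sub>E {1..p} U"
        "nds_comp (nds_vector f p a) 1 m x \<in> Pi\<^sub>E {1..p} V"
      by blast
    show ?R
    proof
      fix i assume i: "i \<in> {1..p}"
      have "x i \<in> U i" "nds_comp f 1 (a i * m) (x i) \<in> V i"
        using PiE_mem[OF x(1) i] PiE_mem[OF x(2) i] by (simp_all only: comp[OF i])
      then show "nds_comp f 1 (a i * m) ` U i \<inter> V i \<noteq> {}" by blast
    qed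
  next
    assume ?R
    then have "\<forall>i\<in>{1..p}. \<exists>y. y \<in> U i \<and> nds_comp f 1 (a i * m) y \<in> V i" by blast
    then obtain y where y: "\<And>i. i \<in> {1..p} \<Longrightarrow> y i \<in> U i \<and> nds_comp f 1 (a i * m) (y i) \<in> V i"
      by metis
    \<comment> \<open>Points of the power are \<open>undefined\<close> off \<open>{1..p}\<close>, so
      the chosen witnesses have to be cut down to that set.\<close>
    let ?x = "restrict y {1..p}"
    have "?x \<in> Pi\<^sub>E {1..p} U" using y by simp
    moreover have "nds_comp (nds_vector f p a) 1 m ?x \<in> Pi\<^sub>E {1..p} V"
    proof (rule PiE_I)
      fix i assume i: "i \<in> {1..p}"
      show "nds_comp (nds_vector f p a) 1 m ?x i \<in> V i"
        unfolding comp[OF i] using y[OF i] i by simp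
    next
      fix i assume "i \<notin> {1..p}"
      then show "nds_comp (nds_vector f p a) 1 m ?x i = undefined"
        unfolding nds_vector_def
        by (rule extensional_arb[OF nds_comp_nds_product_extensional[OF restrict_extensional]])
    qed
    ultimately show ?L by blast
  qed
qed

section \<open>Strong multi-transitivity tested on families of open sets\<close>

text \<open>Boxes are open, and every nonempty open set contains a box with nonempty sides.
  Transitivity of the product therefore only has to be tested on boxes, and there it splits into its
  coordinates.\<close>

lemma multi_transitive_iff:
  "multi_transitive X f p a \<longleftrightarrow>
     (\<forall>U V. (\<forall>i\<in>{1..p}. openin X (U i) \<and> U i \<noteq> {} \<and> openin X (V i) \<and> V i \<noteq> {}) \<longrightarrow>
        (\<exists>m\<ge>1. \<forall>i\<in>{1..p}. nds_comp f 1 (a i * m) ` U i \<inter> V i \<noteq> {}))"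
  (is "_ \<longleftrightarrow> ?R")
proof
  assume L: "multi_transitive X f p a"
  show ?R
  proof (intro allI impI)
    fix U V
    assume UV: "\<forall>i\<in>{1..p}. openin X (U i) \<and> U i \<noteq> {} \<and> openin X (V i) \<and> V i \<noteq> {}"
    then have "openin (power_space X p) (Pi\<^sub>E {1..p} U)" "openin (power_space X p) (Pi\<^sub>E {1..p} V)"
        "Pi\<^sub>E {1..p} U \<noteq> {}" "Pi\<^sub>E {1..p} V \<noteq> {}"
      by (auto intro!: openin_power_space_box simp: PiE_eq_empty_iff simp del: One_nat_def)
    then have "\<exists>m\<ge>1. nds_comp (nds_vector f p a) 1 m ` Pi\<^sub>E {1..p} U \<inter> Pi\<^sub>E {1..p} V \<noteq> {}"
      using L unfolding multi_transitive_def transitive_nds_def by blast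
    then show "\<exists>m\<ge>1. \<forall>i\<in>{1..p}. nds_comp f 1 (a i * m) ` U i \<inter> V i \<noteq> {}"
      unfolding nds_comp_nds_vector_box .
  qed
next
  assume R: ?R
  show "multi_transitive X f p a"
    unfolding multi_transitive_def transitive_nds_def
  proof (intro allI impI, elim conjE)
    fix W Z
    assume W: "openin (power_space X p) W" "W \<noteq> {}" and Z: "openin (power_space X p) Z" "Z \<noteq> {}"
    obtain U where U: "\<And>i. i \<in> {1..p} \<Longrightarrow> openin X (U i)" "\<And>i. i \<in> {1..p} \<Longrightarrow> U i \<noteq> {}"
        "Pi\<^sub>E {1..p} U \<subseteq> W"
      by (rule openin_power_space_contains_box[OF W]) (rule that)
    obtain V where V: "\<And>i. i \<in> {1..p} \<Longrightarrow> openin X (V i)" "\<And>i. i \<in> {1..p} \<Longrightarrow> V i \<noteq> {}"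
        "Pi\<^sub>E {1..p} V \<subseteq> Z"
      by (rule openin_power_space_contains_box[OF Z]) (rule that)
    have "\<forall>i\<in>{1..p}. openin X (U i) \<and> U i \<noteq> {} \<and> openin X (V i) \<and> V i \<noteq> {}"
      using U(1,2) V(1,2) by simp
    with R have "\<exists>m\<ge>1. \<forall>i\<in>{1..p}. nds_comp f 1 (a i * m) ` U i \<inter> V i \<noteq> {}"
      by (elim allE impE)
    then show "\<exists>m\<ge>1. nds_comp (nds_vector f p a) 1 m ` W \<inter> Z \<noteq> {}"
      unfolding nds_comp_nds_vector_box[symmetric] using U(3) V(3) by blast
  qed
qed

lemma strongly_multi_transitiveD:
  fixes a :: "nat \<Rightarrow> nat"
  assumes "strongly_multi_transitive X f" "p \<ge> 1" "\<And>i. i \<in> {1..p} \<Longrightarrow> a i \<ge> 1"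
    and "\<And>i. i \<in> {1..p} \<Longrightarrow> openin X (U i) \<and> U i \<noteq> {} \<and> openin X (V i) \<and> V i \<noteq> {}"
  shows "\<exists>m\<ge>1. \<forall>i\<in>{1..p}. nds_comp f 1 (a i * m) ` U i \<inter> V i \<noteq> {}"
proof -
  have "multi_transitive X f p a"
    using assms(1-3) by (simp add: strongly_multi_transitive_def)
  moreover have "\<forall>i\<in>{1..p}. openin X (U i) \<and> U i \<noteq> {} \<and> openin X (V i) \<and> V i \<noteq> {}"
    using assms(4) by simp
  ultimately show ?thesis
    unfolding multi_transitive_iff by (elim allE impE)
qed

lemma strongly_multi_transitiveI:
  assumes "\<And>(p::nat) a U V. \<lbrakk>p \<ge> 1; \<And>i. i \<in> {1..p} \<Longrightarrow> a i \<ge> 1;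
      \<And>i. i \<in> {1..p} \<Longrightarrow> openin X (U i) \<and> U i \<noteq> {} \<and> openin X (V i) \<and> V i \<noteq> {}\<rbrakk> \<Longrightarrow>
      \<exists>m\<ge>1. \<forall>i\<in>{1..p}. nds_comp f 1 (a i * m) ` U i \<inter> V i \<noteq> {}"
  shows "strongly_multi_transitive X f"
  unfolding strongly_multi_transitive_def multi_transitive_iff by (intro allI impI assms) (simp_all del: One_nat_def)

text \<open>Frees the index set from being an interval, so that pairs of indices can be used for
  powers of powers. An enumeration of \<open>I\<close> turns the family into a vector.\<close>

lemma strongly_multi_transitive_finite_family:
  fixes a :: "'i \<Rightarrow> nat"
  assumes "strongly_multi_transitive X f" "finite I" "\<And>i. i \<in> I \<Longrightarrow> a i \<ge> 1"
    and "\<And>i. i \<in> I \<Longrightarrow> openin X (U i) \<and> U i \<noteq> {} \<and> openin X (V i) \<and> V i \<noteq> {}"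
  shows "\<exists>m\<ge>1. \<forall>i\<in>I. nds_comp f 1 (a i * m) ` U i \<inter> V i \<noteq> {}"
\<comment> \<open>Vectors have length at least 1, so the empty family is treated apart; any
  \<open>m \<ge> 1\<close> serves there.\<close>
proof (cases "I = {}")
  case True
  then show ?thesis by auto
next
  case False
  obtain h where "bij_betw h {1..card I} I"
    using ex_bij_betw_nat_finite_1[OF assms(2)] by blast
  then have h: "h ` {1..card I} = I" by (simp add: bij_betw_def)
  then have hI: "h i \<in> I" if "i \<in> {1..card I}" for i using that by blast
  have "card I \<ge> 1" using False assms(2) by (simp add: Suc_le_eq card_gt_0_iff)
  then have "\<exists>m\<ge>1. \<forall>i\<in>{1..card I}. nds_comp f 1 (a (h i) * m) ` U (h i) \<inter> V (h i) \<noteq> {}"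
    by (rule strongly_multi_transitiveD[OF assms(1) _ assms(3)[OF hI] assms(4)[OF hI]])
  then have "\<exists>m\<ge>1. \<forall>i\<in>h ` {1..card I}. nds_comp f 1 (a i * m) ` U i \<inter> V i \<noteq> {}"
    unfolding ball_simps .
  then show ?thesis unfolding h .
qed

text \<open>Coordinate \<open>i\<close> of the vector system at time \<open>b j * m\<close> is
  \<open>f\<close> at time \<open>a i * b j * m\<close>, so the claim is about one finite family
  indexed by the pairs \<open>(j, i)\<close>. It serves both strong multi-transitivity of the vector
  system and, with \<open>b j = 1\<close>, its weak mixing.\<close>

lemma strongly_multi_transitive_vector_family:
  fixes p :: nat and b :: "nat \<Rightarrow> nat"
  assumes "strongly_multi_transitive X f" "\<And>i. i \<in> {1..r} \<Longrightarrow> a i \<ge> 1"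
    and "\<And>j. j \<in> {1..p} \<Longrightarrow> b j \<ge> 1"
    and UV: "\<And>j. j \<in> {1..p} \<Longrightarrow> openin (power_space X r) (U j) \<and> U j \<noteq> {} \<and>
      openin (power_space X r) (V j) \<and> V j \<noteq> {}"
  shows "\<exists>m\<ge>1. \<forall>j\<in>{1..p}. nds_comp (nds_vector f r a) 1 (b j * m) ` U j \<inter> V j \<noteq> {}"
proof -
  have "\<exists>A. (\<forall>i\<in>{1..r}. openin X (A i) \<and> A i \<noteq> {}) \<and> Pi\<^sub>E {1..r} A \<subseteq> U j" if "j \<in> {1..p}" for j
    by (rule openin_power_space_contains_box[of X r "U j"]) (use UV[OF that] in blast)+
  then obtain A where A: "\<And>i j. j \<in> {1..p} \<Longrightarrow> i \<in> {1..r} \<Longrightarrow> openin X (A j i) \<and> A j i \<noteq> {}"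
      "\<And>j. j \<in> {1..p} \<Longrightarrow> Pi\<^sub>E {1..r} (A j) \<subseteq> U j"
    by metis
  have "\<exists>B. (\<forall>i\<in>{1..r}. openin X (B i) \<and> B i \<noteq> {}) \<and> Pi\<^sub>E {1..r} B \<subseteq> V j" if "j \<in> {1..p}" for j
    by (rule openin_power_space_contains_box[of X r "V j"]) (use UV[OF that] in blast)+
  then obtain B where B: "\<And>i j. j \<in> {1..p} \<Longrightarrow> i \<in> {1..r} \<Longrightarrow> openin X (B j i) \<and> B j i \<noteq> {}"
      "\<And>j. j \<in> {1..p} \<Longrightarrow> Pi\<^sub>E {1..r} (B j) \<subseteq> V j"
    by metis
  \<comment> \<open>In \<open>z\<close>, the first entry numbers the pair of open sets and the
    second the coordinate; a single \<open>m\<close> handles all of them.\<close>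
  have "\<exists>m\<ge>1. \<forall>z\<in>{1..p} \<times> {1..r}.
      nds_comp f 1 (a (snd z) * b (fst z) * m) ` A (fst z) (snd z) \<inter> B (fst z) (snd z) \<noteq> {}"
  proof (rule strongly_multi_transitive_finite_family[OF assms(1)])
    fix z assume "z \<in> {1..p} \<times> {1..r}"
    then have z: "fst z \<in> {1..p}" "snd z \<in> {1..r}" by auto
    show "a (snd z) * b (fst z) \<ge> 1"
      using assms(2)[OF z(2)] assms(3)[OF z(1)] by simp
    show "openin X (A (fst z) (snd z)) \<and> A (fst z) (snd z) \<noteq> {} \<and>
        openin X (B (fst z) (snd z)) \<and> B (fst z) (snd z) \<noteq> {}"
      using A(1)[OF z] B(1)[OF z] by simp
  qed simp
  then obtain m where m: "m \<ge> 1" "\<forall>z\<in>{1..p} \<times> {1..r}.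
      nds_comp f 1 (a (snd z) * b (fst z) * m) ` A (fst z) (snd z) \<inter> B (fst z) (snd z) \<noteq> {}"
    by blast
  have "nds_comp (nds_vector f r a) 1 (b j * m) ` U j \<inter> V j \<noteq> {}" if j: "j \<in> {1..p}" for j
  proof -
    have "\<forall>i\<in>{1..r}. nds_comp f 1 (a i * (b j * m)) ` A j i \<inter> B j i \<noteq> {}"
      using m(2)[rule_format, of "(j, i)" for i] j by (simp add: mult.assoc)
    then have "nds_comp (nds_vector f r a) 1 (b j * m) ` Pi\<^sub>E {1..r} (A j) \<inter> Pi\<^sub>E {1..r} (B j) \<noteq> {}"
      unfolding nds_comp_nds_vector_box .
    then show ?thesis using A(2)[OF j] B(2)[OF j] by blast
  qed
  then show ?thesis using m(1) by blast
qed

section \<open>The three equivalences\<close>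

text \<open>Time \<open>m\<close> of the iterate is time \<open>n * m\<close> of \<open>f\<close>.
  One direction absorbs \<open>n\<close> into the vector, the other into the time.\<close>

lemma strongly_multi_transitive_nds_iterate_iff:
  assumes "n \<ge> 1"
  shows "strongly_multi_transitive X (nds_iterate f n) \<longleftrightarrow> strongly_multi_transitive X f"
proof
  assume S: "strongly_multi_transitive X f"
  show "strongly_multi_transitive X (nds_iterate f n)"
  proof (rule strongly_multi_transitiveI)
    fix p and a :: "nat \<Rightarrow> nat" and U V :: "nat \<Rightarrow> 'a set"
    assume H: "p \<ge> 1" "\<And>i. i \<in> {1..p} \<Longrightarrow> a i \<ge> 1"
      "\<And>i. i \<in> {1..p} \<Longrightarrow> openin X (U i) \<and> U i \<noteq> {} \<and> openin X (V i) \<and> V i \<noteq> {}"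
    have "n * a i \<ge> 1" if "i \<in> {1..p}" for i
      using H(2)[OF that] assms by simp
    from H(1) this H(3)
    have "\<exists>m\<ge>1. \<forall>i\<in>{1..p}. nds_comp f 1 (n * a i * m) ` U i \<inter> V i \<noteq> {}"
      by (rule strongly_multi_transitiveD[OF S])
    then show "\<exists>m\<ge>1. \<forall>i\<in>{1..p}. nds_comp (nds_iterate f n) 1 (a i * m) ` U i \<inter> V i \<noteq> {}"
      unfolding nds_comp_nds_iterate mult.assoc .
  qed
next
  assume S: "strongly_multi_transitive X (nds_iterate f n)"
  show "strongly_multi_transitive X f"
  proof (rule strongly_multi_transitiveI)
    fix p and a :: "nat \<Rightarrow> nat" and U V :: "nat \<Rightarrow> 'a set"
    assume H: "p \<ge> 1" "\<And>i. i \<in> {1..p} \<Longrightarrow> a i \<ge> 1"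
      "\<And>i. i \<in> {1..p} \<Longrightarrow> openin X (U i) \<and> U i \<noteq> {} \<and> openin X (V i) \<and> V i \<noteq> {}"
    have "\<exists>m\<ge>1. \<forall>i\<in>{1..p}. nds_comp (nds_iterate f n) 1 (a i * m) ` U i \<inter> V i \<noteq> {}"
      by (rule strongly_multi_transitiveD[OF S H])
    then obtain m where m: "m \<ge> 1" "\<forall>i\<in>{1..p}. nds_comp f 1 (a i * (n * m)) ` U i \<inter> V i \<noteq> {}"
      unfolding nds_comp_nds_iterate mult.left_commute[of n] by blast
    moreover have "n * m \<ge> 1" using m(1) assms by simp
    ultimately show "\<exists>m\<ge>1. \<forall>i\<in>{1..p}. nds_comp f 1 (a i * m) ` U i \<inter> V i \<noteq> {}"
      by blast
  qed
qed

lemma strongly_multi_transitive_nds_vector_iff: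
  assumes "r \<ge> 1" "\<And>i. i \<in> {1..r} \<Longrightarrow> a i \<ge> 1"
  shows "strongly_multi_transitive (power_space X r) (nds_vector f r a)
    \<longleftrightarrow> strongly_multi_transitive X f"
proof
  assume S: "strongly_multi_transitive X f"
  show "strongly_multi_transitive (power_space X r) (nds_vector f r a)"
    by (rule strongly_multi_transitiveI, rule strongly_multi_transitive_vector_family[OF S assms(2)])
next
  assume S: "strongly_multi_transitive (power_space X r) (nds_vector f r a)"
  show "strongly_multi_transitive X f"
  proof (rule strongly_multi_transitiveI)
    fix p and b :: "nat \<Rightarrow> nat" and U V :: "nat \<Rightarrow> 'a set"
    assume H: "p \<ge> 1" "\<And>i. i \<in> {1..p} \<Longrightarrow> b i \<ge> 1"
      "\<And>i. i \<in> {1..p} \<Longrightarrow> openin X (U i) \<and> U i \<noteq> {} \<and> openin X (V i) \<and> V i \<noteq> {}"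
    \<comment> \<open>With equal sides, every coordinate tests the same pair \<open>U i\<close>,
      \<open>V i\<close>, so one coordinate can be read off later.\<close>
    have "openin (power_space X r) (Pi\<^sub>E {1..r} (\<lambda>_. U i)) \<and> Pi\<^sub>E {1..r} (\<lambda>_. U i) \<noteq> {} \<and>
        openin (power_space X r) (Pi\<^sub>E {1..r} (\<lambda>_. V i)) \<and> Pi\<^sub>E {1..r} (\<lambda>_. V i) \<noteq> {}"
      if "i \<in> {1..p}" for i
      using H(3)[OF that] by (simp add: openin_power_space_box PiE_eq_empty_iff del: One_nat_def)
    from H(1,2) this
    have "\<exists>m\<ge>1. \<forall>j\<in>{1..p}. nds_comp (nds_vector f r a) 1 (b j * m) `
        Pi\<^sub>E {1..r} (\<lambda>_. U j) \<inter> Pi\<^sub>E {1..r} (\<lambda>_. V j) \<noteq> {}"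
      by (rule strongly_multi_transitiveD[OF S])
    then obtain m where m: "m \<ge> 1"
        "\<forall>j\<in>{1..p}. \<forall>i\<in>{1..r}. nds_comp f 1 (b j * (a i * m)) ` U j \<inter> V j \<noteq> {}"
      unfolding nds_comp_nds_vector_box mult.left_commute[of "a _"] by blast
    \<comment> \<open>Coordinate 1 exists in every power; it yields the time \<open>a 1 * m\<close>
      for \<open>f\<close>, the same for all \<open>j\<close>.\<close>
    have "1 \<in> {1..r}" using assms(1) by simp
    then have "a 1 * m \<ge> 1" "\<forall>j\<in>{1..p}. nds_comp f 1 (b j * (a 1 * m)) ` U j \<inter> V j \<noteq> {}"
      using m assms(2)[of 1] by auto
    then show "\<exists>m\<ge>1. \<forall>j\<in>{1..p}. nds_comp f 1 (b j * m) ` U j \<inter> V j \<noteq> {}"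
      by blast
  qed
qed

text \<open>Weak mixing of the product of the first \<open>k\<close> iterates handles all multiples
  \<open>i * m\<close> with \<open>i \<le> k\<close> at once. A vector \<open>b\<close> with entries
  at most \<open>k\<close> thus only selects coordinates, one for each pair of open sets.\<close>

lemma strongly_multi_transitive_iff_weakly_mixing:
  "strongly_multi_transitive X f \<longleftrightarrow>
     (\<forall>k\<ge>1. weakly_mixing_all_orders (power_space X k) (nds_vector f k (\<lambda>i. i)))"
proof
  assume S: "strongly_multi_transitive X f"
  show "\<forall>k\<ge>1. weakly_mixing_all_orders (power_space X k) (nds_vector f k (\<lambda>i. i))"
    unfolding weakly_mixing_all_orders_def weakly_mixing_of_order_def
  proof (intro allI impI)
    fix k n and U V :: "nat \<Rightarrow> (nat \<Rightarrow> 'a) set"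
    assume UV: "\<forall>j\<in>{1..n}. openin (power_space X k) (U j) \<and> U j \<noteq> {} \<and>
      openin (power_space X k) (V j) \<and> V j \<noteq> {}"
    \<comment> \<open>The factor \<open>1\<close> stands for the constant vector
      \<open>b j = 1\<close>: weak mixing uses one time for all pairs.\<close>
    have "\<exists>m\<ge>1. \<forall>j\<in>{1..n}. nds_comp (nds_vector f k (\<lambda>i. i)) 1 (1 * m) ` U j \<inter> V j \<noteq> {}"
      using UV by (intro strongly_multi_transitive_vector_family[OF S]) auto
    then show "\<exists>m\<ge>1. \<forall>j\<in>{1..n}. nds_comp (nds_vector f k (\<lambda>i. i)) 1 m ` U j \<inter> V j \<noteq> {}"
      by simp
  qed
next
  assume W: "\<forall>k\<ge>1. weakly_mixing_all_orders (power_space X k) (nds_vector f k (\<lambda>i. i))"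
  show "strongly_multi_transitive X f"
  proof (rule strongly_multi_transitiveI)
    fix p and b :: "nat \<Rightarrow> nat" and U V :: "nat \<Rightarrow> 'a set"
    assume H: "p \<ge> 1" "\<And>i. i \<in> {1..p} \<Longrightarrow> b i \<ge> 1"
      "\<And>i. i \<in> {1..p} \<Longrightarrow> openin X (U i) \<and> U i \<noteq> {} \<and> openin X (V i) \<and> V i \<noteq> {}"
    \<comment> \<open>With this \<open>k\<close>, every \<open>b j\<close> is itself the index of a
      coordinate of the product.\<close>
    define k where "k = Max (b ` {1..p})"
    have bk: "b j \<in> {1..k}" if "j \<in> {1..p}" for j
      using H(2)[OF that] that by (simp add: k_def)
    then have "k \<ge> 1" using H(1) by fastforce
    \<comment> \<open>Weak mixing only speaks of orders at least 2, so for \<open>p = 1\<close> the single pair is doubled.\<close>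
    define U' V' where "U' j = Pi\<^sub>E {1..k} (\<lambda>_. U (min j p))"
      and "V' j = Pi\<^sub>E {1..k} (\<lambda>_. V (min j p))" for j
    have "weakly_mixing_of_order (Suc p) (power_space X k) (nds_vector f k (\<lambda>i. i))"
      using W \<open>k \<ge> 1\<close> H(1) by (simp add: weakly_mixing_all_orders_def)
    moreover have "\<forall>j\<in>{1..Suc p}. openin (power_space X k) (U' j) \<and> U' j \<noteq> {} \<and>
        openin (power_space X k) (V' j) \<and> V' j \<noteq> {}"
    proof
      fix j assume "j \<in> {1..Suc p}"
      then have "min j p \<in> {1..p}" using H(1) by auto
      then show "openin (power_space X k) (U' j) \<and> U' j \<noteq> {} \<and>
          openin (power_space X k) (V' j) \<and> V' j \<noteq> {}"
        using H(3) by (simp add: U'_def V'_def openin_power_space_box PiE_eq_empty_iff del: One_nat_def)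
    qed
    ultimately have "\<exists>m\<ge>1. \<forall>j\<in>{1..Suc p}.
        nds_comp (nds_vector f k (\<lambda>i. i)) 1 m ` U' j \<inter> V' j \<noteq> {}"
      unfolding weakly_mixing_of_order_def by (elim allE impE)
    then obtain m where m: "m \<ge> 1" "\<forall>j\<in>{1..Suc p}. \<forall>i\<in>{1..k}.
        nds_comp f 1 (i * m) ` U (min j p) \<inter> V (min j p) \<noteq> {}"
      unfolding U'_def V'_def nds_comp_nds_vector_box by blast
    \<comment> \<open>Of the \<open>j\<close>-th pair of boxes only coordinate \<open>b j\<close> is
      kept; the extra index \<open>Suc p\<close> is dropped.\<close>
    have "nds_comp f 1 (b j * m) ` U j \<inter> V j \<noteq> {}" if "j \<in> {1..p}" for j
    proof -
      have "min j p = j" "j \<in> {1..Suc p}" using that by auto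
      then show ?thesis using m(2) bk[OF that] by metis
    qed
    then show "\<exists>m\<ge>1. \<forall>j\<in>{1..p}. nds_comp f 1 (b j * m) ` U j \<inter> V j \<noteq> {}"
      using m(1) by blast
  qed
qed

theorem theorem2:
  fixes X :: "'a topology" and f :: "nat \<Rightarrow> 'a \<Rightarrow> 'a"
    and n r :: nat and a :: "nat \<Rightarrow> nat"
  assumes "nds X f" and "n \<ge> 1" and "r \<ge> 1" and "\<forall>i\<in>{1..r}. a i \<ge> 1"
  shows "(strongly_multi_transitive X f
            \<longleftrightarrow> strongly_multi_transitive X (nds_iterate f n))
       \<and> (strongly_multi_transitive X f
            \<longleftrightarrow> strongly_multi_transitive (power_space X r) (nds_vector f r a))
       \<and> (strongly_multi_transitive X f
            \<longleftrightarrow> (\<forall>k\<ge>1. weakly_mixing_all_orders (power_space X k) (nds_vector f k (\<lambda>i. i))))"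
  using strongly_multi_transitive_nds_iterate_iff[OF assms(2), of X f]
    strongly_multi_transitive_nds_vector_iff[OF assms(3), of a X f] assms(4)
    strongly_multi_transitive_iff_weakly_mixing[of X f]
  by blast

end
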